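(* Let $E$ and $F$ be two Banach lattices such that $E^*$ has weakly sequentially continuous lattice operations. If $T:E\to F$ is an operator, then $T(A)$ is an almost Dunford-Pettis set in $F$ whenever $A$ is an almost Dunford-Pettis solid set in $E$.
   Context: "Operator" means bounded linear operator. $E^*$ denotes the dual of $E$, a Banach lattice under the dual norm and pointwise order. A subset $A$ of a Banach lattice $E$ is called almost Dunford-Pettis if every disjoint weakly null sequence $(f_n)$ in $E^*$ converges uniformly to $0$ on $A$, i.e. $\lim_{n\to\infty}\sup_{a\in A}|f_n(a)|=0$. A subset $A$ of $E$ is called solid if $|x|\le|y|$ for some $y\in A$ implies $x\in A$. The lattice operations in a Banach lattice $G$ are weakly sequentially continuous if for every weakly null sequence $(x_n)$ in $G$, $|x_n|\to 0$ for $\sigma(G,G^* )$; here this is applied to $G=E^*$.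
   Formalization: Almost Dunford-Pettis sets are taken to be norm bounded by definition, both for A and for T(A); without norm boundedness the claim fails, e.g. E = A = ℝ, F = c₀, T(1) = (1/n). *)

theory Defs
  imports "HOL-Analysis.Analysis" "HOL-Library.Lattice_Algebras"
begin

section \<open>Banach lattices\<close>

text \<open>
  The class \<^class>\<open>lattice_ab_group_add_abs\<close> provides the modulus
  \<^term>\<open>\<bar>x\<bar> = sup x (- x)\<close>.
\<close>

class banach_lattice = banach + ordered_real_vector + lattice_ab_group_add_abs +
  assumes norm_mono_abs: "\<bar>x\<bar> \<le> \<bar>y\<bar> \<Longrightarrow> norm x \<le> norm y"

instance real :: banach_lattice
  by standard simp

lemma norm_abs_eq [simp]: "norm \<bar>x\<bar> = norm (x::'a::banach_lattice)"
  by (intro antisym norm_mono_abs) simp_all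

lemma norm_mono_pos:
  fixes x y :: "'a::banach_lattice"
  assumes "0 \<le> x" "x \<le> y"
  shows "norm x \<le> norm y"
  using assms by (intro norm_mono_abs) simp

section \<open>The dual space\<close>

text \<open>
  A copy of the bounded linear functionals \<^typ>\<open>'a \<Rightarrow>\<^sub>L real\<close> with the operator norm. The
  copy is needed because a lattice structure cannot be put on the type constructor
  \<^type>\<open>blinfun\<close> for the codomain \<^typ>\<open>real\<close> alone.
\<close>

typedef (overloaded) 'a dual = "UNIV :: ('a::real_normed_vector \<Rightarrow>\<^sub>L real) set"
  morphisms blinfun_of_dual Dual ..

setup_lifting type_definition_dual

lift_definition dual_apply :: "'a::real_normed_vector dual \<Rightarrow> 'a \<Rightarrow> real"
  is blinfun_apply .

instantiation dual :: (real_normed_vector) real_normed_vector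
begin

lift_definition zero_dual :: "'a dual" is 0 .
lift_definition uminus_dual :: "'a dual \<Rightarrow> 'a dual" is uminus .
lift_definition plus_dual :: "'a dual \<Rightarrow> 'a dual \<Rightarrow> 'a dual" is "(+)" .
lift_definition minus_dual :: "'a dual \<Rightarrow> 'a dual \<Rightarrow> 'a dual" is "(-)" .
lift_definition scaleR_dual :: "real \<Rightarrow> 'a dual \<Rightarrow> 'a dual" is scaleR .
lift_definition norm_dual :: "'a dual \<Rightarrow> real" is norm .
definition dist_dual :: "'a dual \<Rightarrow> 'a dual \<Rightarrow> real"
  where "dist_dual f g = norm (f - g)"
definition sgn_dual :: "'a dual \<Rightarrow> 'a dual"
  where "sgn_dual f = scaleR (inverse (norm f)) f"
definition uniformity_dual :: "('a dual \<times> 'a dual) filter"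
  where "uniformity_dual = (INF e\<in>{0<..}. principal {(f, g). dist f g < e})"
definition open_dual :: "'a dual set \<Rightarrow> bool"
  where "open_dual U = (\<forall>f\<in>U. \<forall>\<^sub>F (f', g) in uniformity. f' = f \<longrightarrow> g \<in> U)"

instance
proof
  fix a b c :: "'a dual" and r s :: real
  show "a + b + c = a + (b + c)" by transfer simp
  show "a + b = b + a" by transfer simp
  show "0 + a = a" by transfer simp
  show "- a + a = 0" by transfer simp
  show "a - b = a + - b" by transfer simp
  show "r *\<^sub>R (a + b) = r *\<^sub>R a + r *\<^sub>R b" by transfer (rule scaleR_add_right)
  show "(r + s) *\<^sub>R a = r *\<^sub>R a + s *\<^sub>R a" by transfer (rule scaleR_add_left)
  show "r *\<^sub>R s *\<^sub>R a = (r * s) *\<^sub>R a" by transfer simp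
  show "1 *\<^sub>R a = a" by transfer simp
  show "(norm a = 0) = (a = 0)" by transfer simp
  show "norm (a + b) \<le> norm a + norm b" by transfer (rule norm_triangle_ineq)
  show "norm (r *\<^sub>R a) = \<bar>r\<bar> * norm a" by transfer simp
qed (simp_all add: dist_dual_def sgn_dual_def uniformity_dual_def open_dual_def)

end

instance dual :: (real_normed_vector) banach
proof
  fix X :: "nat \<Rightarrow> 'a dual"
  assume X: "Cauchy X"
  have dist: "dist (blinfun_of_dual f) (blinfun_of_dual g) = dist f g" for f g :: "'a dual"
    by (simp add: dist_dual_def dist_norm norm_dual.rep_eq minus_dual.rep_eq)
  have "Cauchy (\<lambda>n. blinfun_of_dual (X n))"
    using X by (simp add: Cauchy_def dist)
  then obtain L where L: "(\<lambda>n. blinfun_of_dual (X n)) \<longlonglongrightarrow> L"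
    by (auto simp: Cauchy_convergent_iff convergent_def)
  have "dist (X n) (Dual L) = dist (blinfun_of_dual (X n)) L" for n
    using dist[of "X n" "Dual L"] by (simp add: Dual_inverse)
  with L have "X \<longlonglongrightarrow> Dual L"
    by (simp add: tendsto_iff)
  thus "convergent X"
    by (auto simp: convergent_def)
qed

lemma dual_eqI: "(\<And>x. dual_apply f x = dual_apply g x) \<Longrightarrow> f = g"
  by transfer (rule blinfun_eqI)

lemma bounded_linear_dual_apply: "bounded_linear (dual_apply f)"
  by transfer (rule blinfun.bounded_linear_right)

lemma dual_apply_zero_left [simp]: "dual_apply 0 x = 0"
  by transfer simp
lemma dual_apply_uminus_left [simp]: "dual_apply (- f) x = - dual_apply f x"
  by transfer (rule blinfun.minus_left)
lemma dual_apply_add_left [simp]: "dual_apply (f + g) x = dual_apply f x + dual_apply g x"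
  by transfer (rule blinfun.add_left)
lemma dual_apply_diff_left [simp]: "dual_apply (f - g) x = dual_apply f x - dual_apply g x"
  by transfer (rule blinfun.diff_left)
lemma dual_apply_scaleR_left [simp]: "dual_apply (r *\<^sub>R f) x = r * dual_apply f x"
  by transfer (simp add: blinfun.scaleR_left)

lemma dual_apply_zero_right [simp]: "dual_apply f 0 = 0"
  by transfer simp
lemma dual_apply_uminus_right [simp]: "dual_apply f (- x) = - dual_apply f x"
  by transfer (rule blinfun.minus_right)
lemma dual_apply_add_right [simp]: "dual_apply f (x + y) = dual_apply f x + dual_apply f y"
  by transfer (rule blinfun.add_right)
lemma dual_apply_diff_right [simp]: "dual_apply f (x - y) = dual_apply f x - dual_apply f y"
  by transfer (rule blinfun.diff_right)
lemma dual_apply_scaleR_right [simp]: "dual_apply f (r *\<^sub>R x) = r * dual_apply f x"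
  by transfer (simp add: blinfun.scaleR_right)

lemma norm_dual_bound: "\<bar>dual_apply f x\<bar> \<le> norm f * norm x"
  by transfer (metis norm_blinfun real_norm_def)

lemma norm_dual_le:
  assumes "0 \<le> b" "\<And>x. \<bar>dual_apply f x\<bar> \<le> b * norm x"
  shows "norm f \<le> b"
  using assms by transfer (simp add: norm_blinfun_bound)

lemma norm_dual_eq_onorm: "norm f = onorm (dual_apply f)"
  by transfer (rule norm_blinfun.rep_eq)

lemma ex_dual:
  assumes "bounded_linear h"
  shows "\<exists>f. \<forall>x. dual_apply f x = h x"
proof
  show "\<forall>x. dual_apply (Dual (Blinfun h)) x = h x"
    using assms by (simp add: dual_apply.rep_eq Dual_inverse bounded_linear_Blinfun_apply)
qed

section \<open>The dual Banach lattice\<close>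

text \<open>
  The order is the pointwise one on the positive cone; this determines the lattice operations.
  Their existence is the Riesz--Kantorovich theorem.
\<close>

instantiation dual :: (banach_lattice) order
begin

definition less_eq_dual :: "'a dual \<Rightarrow> 'a dual \<Rightarrow> bool"
  where "less_eq_dual f g \<longleftrightarrow> (\<forall>x\<ge>0. dual_apply f x \<le> dual_apply g x)"
definition less_dual :: "'a dual \<Rightarrow> 'a dual \<Rightarrow> bool"
  where "less_dual f g \<longleftrightarrow> f \<le> g \<and> \<not> g \<le> f"

instance
proof
  fix f g h :: "'a dual"
  show "f < g \<longleftrightarrow> f \<le> g \<and> \<not> g \<le> f" by (rule less_dual_def)
  show "f \<le> f" by (simp add: less_eq_dual_def)
  show "f \<le> g \<Longrightarrow> g \<le> h \<Longrightarrow> f \<le> h" by (meson less_eq_dual_def order_trans)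
  show "f = g" if "f \<le> g" "g \<le> f"
  proof (rule dual_eqI)
    fix x :: 'a
    have eq: "dual_apply f y = dual_apply g y" if "0 \<le> y" for y
      using \<open>f \<le> g\<close> \<open>g \<le> f\<close> that by (auto simp: less_eq_dual_def intro: antisym)
    have "dual_apply f (pprt x - (- nprt x)) = dual_apply g (pprt x - (- nprt x))"
      unfolding dual_apply_diff_right by (simp add: eq flip: dual_apply_uminus_right)
    thus "dual_apply f x = dual_apply g x"
      using prts[of x] by simp
  qed
qed

end

definition dual_pos_part_at :: "'a::banach_lattice dual \<Rightarrow> 'a \<Rightarrow> real"
  where "dual_pos_part_at f x = (SUP y\<in>{0..x}. dual_apply f y)"

lemma dual_apply_interval_bdd:
  fixes f :: "'a::banach_lattice dual"
  shows "bdd_above (dual_apply f ` {0..x})"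
proof (rule bdd_aboveI2)
  fix y assume y: "y \<in> {0..x}"
  have "dual_apply f y \<le> norm f * norm y"
    using norm_dual_bound[of f y] by simp
  also have "\<dots> \<le> norm f * norm x"
    using y by (intro mult_left_mono norm_mono_pos) auto
  finally show "dual_apply f y \<le> norm f * norm x" .
qed

lemma dual_pos_part_at_upper:
  "0 \<le> y \<Longrightarrow> y \<le> x \<Longrightarrow> dual_apply f y \<le> dual_pos_part_at f x"
  unfolding dual_pos_part_at_def by (intro cSUP_upper dual_apply_interval_bdd) simp

lemma dual_pos_part_at_least:
  "0 \<le> x \<Longrightarrow> (\<And>y. 0 \<le> y \<Longrightarrow> y \<le> x \<Longrightarrow> dual_apply f y \<le> c) \<Longrightarrow> dual_pos_part_at f x \<le> c"
  unfolding dual_pos_part_at_def by (intro cSUP_least) auto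

lemma dual_pos_part_at_nonneg: "0 \<le> x \<Longrightarrow> 0 \<le> dual_pos_part_at f x"
  using dual_pos_part_at_upper[of 0 x f] by simp

lemma dual_pos_part_at_le_norm:
  assumes "0 \<le> x"
  shows "dual_pos_part_at f x \<le> norm f * norm x"
proof (rule dual_pos_part_at_least[OF assms])
  fix y assume y: "0 \<le> y" "y \<le> x"
  have "dual_apply f y \<le> norm f * norm y"
    using norm_dual_bound[of f y] by simp
  also have "\<dots> \<le> norm f * norm x"
    using y by (intro mult_left_mono norm_mono_pos) auto
  finally show "dual_apply f y \<le> norm f * norm x" .
qed

lemma dual_pos_part_at_add:
  assumes x: "0 \<le> x" and y: "0 \<le> y"
  shows "dual_pos_part_at f (x + y) = dual_pos_part_at f x + dual_pos_part_at f y"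
proof (rule antisym)
  show "dual_pos_part_at f (x + y) \<le> dual_pos_part_at f x + dual_pos_part_at f y"
  proof (rule dual_pos_part_at_least)
    show "0 \<le> x + y" using x y by simp
    fix z assume z: "0 \<le> z" "z \<le> x + y"
    define z1 where "z1 = inf z x"
    have "0 \<le> z1" "z1 \<le> x" "z1 \<le> z" using x z by (simp_all add: z1_def)
    moreover have "z - z1 \<le> y"
    proof -
      have "z - y \<le> z1" using y z by (simp add: z1_def diff_le_eq)
      thus ?thesis by (simp add: algebra_simps)
    qed
    ultimately have "dual_apply f z1 \<le> dual_pos_part_at f x"
      "dual_apply f (z - z1) \<le> dual_pos_part_at f y"
      by (intro dual_pos_part_at_upper; simp)+
    thus "dual_apply f z \<le> dual_pos_part_at f x + dual_pos_part_at f y" by simp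
  qed
  have "dual_pos_part_at f x \<le> dual_pos_part_at f (x + y) - dual_pos_part_at f y"
  proof (rule dual_pos_part_at_least[OF x])
    fix u assume u: "0 \<le> u" "u \<le> x"
    have "dual_pos_part_at f y \<le> dual_pos_part_at f (x + y) - dual_apply f u"
    proof (rule dual_pos_part_at_least[OF y])
      fix v assume v: "0 \<le> v" "v \<le> y"
      have "dual_apply f (u + v) \<le> dual_pos_part_at f (x + y)"
        using u v by (intro dual_pos_part_at_upper add_mono) simp_all
      thus "dual_apply f v \<le> dual_pos_part_at f (x + y) - dual_apply f u" by simp
    qed
    thus "dual_apply f u \<le> dual_pos_part_at f (x + y) - dual_pos_part_at f y" by simp
  qed
  thus "dual_pos_part_at f x + dual_pos_part_at f y \<le> dual_pos_part_at f (x + y)" by simp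
qed

lemma dual_pos_part_at_scaleR_le:
  assumes r: "0 < r" and x: "0 \<le> x"
  shows "dual_pos_part_at f (r *\<^sub>R x) \<le> r * dual_pos_part_at f x"
proof (rule dual_pos_part_at_least)
  show "0 \<le> r *\<^sub>R x" using r x by (simp add: scaleR_nonneg_nonneg)
  fix y assume y: "0 \<le> y" "y \<le> r *\<^sub>R x"
  have "0 \<le> inverse r *\<^sub>R y" using r y by (simp add: scaleR_nonneg_nonneg)
  moreover have "inverse r *\<^sub>R y \<le> inverse r *\<^sub>R (r *\<^sub>R x)"
    using r y by (intro scaleR_left_mono) simp_all
  hence "inverse r *\<^sub>R y \<le> x" using r by simp
  ultimately have "dual_apply f (inverse r *\<^sub>R y) \<le> dual_pos_part_at f x"
    by (rule dual_pos_part_at_upper)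
  thus "dual_apply f y \<le> r * dual_pos_part_at f x"
    using r by (simp add: field_simps)
qed

lemma dual_pos_part_at_scaleR:
  assumes r: "0 \<le> r" and x: "0 \<le> x"
  shows "dual_pos_part_at f (r *\<^sub>R x) = r * dual_pos_part_at f x"
proof (cases "r = 0")
  case True
  thus ?thesis by (simp add: dual_pos_part_at_def)
next
  case False
  hence r: "0 < r" using r by simp
  have "dual_pos_part_at f (inverse r *\<^sub>R (r *\<^sub>R x)) \<le> inverse r * dual_pos_part_at f (r *\<^sub>R x)"
    using r x by (intro dual_pos_part_at_scaleR_le scaleR_nonneg_nonneg) simp_all
  hence "r * dual_pos_part_at f x \<le> dual_pos_part_at f (r *\<^sub>R x)"
    using r by (simp add: field_simps)
  thus ?thesis
    using dual_pos_part_at_scaleR_le[OF r x, of f] by simp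
qed

lemma ex_dual_pos_part:
  fixes f :: "'a::banach_lattice dual"
  shows "\<exists>g. \<forall>x\<ge>0. dual_apply g x = dual_pos_part_at f x"
proof -
  define p where "p = dual_pos_part_at f"
  define h where "h x = p (pprt x) - p (- nprt x)" for x
  have p_add: "p (x + y) = p x + p y" if "0 \<le> x" "0 \<le> y" for x y
    using that by (simp add: p_def dual_pos_part_at_add)
  have h_diff: "h (u - v) = p u - p v" if "0 \<le> u" "0 \<le> v" for u v
  proof -
    have "u + - nprt (u - v) = v + pprt (u - v)"
      using prts[of "u - v"] by (simp add: algebra_simps)
    hence "p (u + - nprt (u - v)) = p (v + pprt (u - v))" by simp
    hence "p u + p (- nprt (u - v)) = p v + p (pprt (u - v))"
      using that by (subst (asm) (1 2) p_add) simp_all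
    thus ?thesis by (simp add: h_def)
  qed
  have dec: "x = pprt x - (- nprt x)" for x :: 'a
    using prts[of x] by simp
  have "bounded_linear h"
  proof (rule bounded_linear_intro)
    fix x y :: 'a and r :: real
    have "x + y = (pprt x + pprt y) - (- nprt x + - nprt y)"
    proof -
      have "x + y = (pprt x + nprt x) + (pprt y + nprt y)" by (simp flip: prts)
      thus ?thesis by (simp add: algebra_simps)
    qed
    hence "h (x + y) = p (pprt x + pprt y) - p (- nprt x + - nprt y)"
      by (simp only:) (rule h_diff; intro add_nonneg_nonneg; simp)
    also have "\<dots> = h x + h y"
      by (subst (1 2) p_add) (simp_all add: h_def)
    finally show "h (x + y) = h x + h y" .
    have pos: "h (r *\<^sub>R x) = r * h x" if "0 \<le> r" for r x
    proof -
      have "r *\<^sub>R x = r *\<^sub>R pprt x - r *\<^sub>R (- nprt x)"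
        by (subst dec) (simp only: scaleR_diff_right)
      hence "h (r *\<^sub>R x) = p (r *\<^sub>R pprt x) - p (r *\<^sub>R (- nprt x))"
        using that by (simp only:) (rule h_diff, intro scaleR_nonneg_nonneg, simp_all add: scaleR_nonneg_nonpos)
      also have "\<dots> = r * h x"
        using that by (subst (1 2) p_def, subst (1 2) dual_pos_part_at_scaleR)
          (simp_all add: h_def p_def right_diff_distrib)
      finally show ?thesis .
    qed
    have neg: "h (- x) = - h x" for x
    proof -
      have "- x = (- nprt x) - pprt x" using prts[of x] by (simp add: algebra_simps)
      hence "h (- x) = p (- nprt x) - p (pprt x)" by (simp only:) (rule h_diff, simp_all)
      thus ?thesis by (simp add: h_def)
    qed
    show "h (r *\<^sub>R x) = r *\<^sub>R h x"
    proof (cases "0 \<le> r")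
      case True
      thus ?thesis by (simp add: pos)
    next
      case False
      hence "h ((- r) *\<^sub>R (- x)) = (- r) * h (- x)" by (intro pos) simp
      thus ?thesis by (simp add: neg)
    qed
    have part: "p z \<le> norm f * norm x" if "0 \<le> z" "z \<le> \<bar>x\<bar>" for z
    proof -
      have "p z \<le> norm f * norm z"
        using that by (simp add: p_def dual_pos_part_at_le_norm)
      also have "\<dots> \<le> norm f * norm \<bar>x\<bar>"
        using that by (intro mult_left_mono norm_mono_pos) simp_all
      finally show ?thesis by simp
    qed
    have "0 \<le> p (pprt x)" "0 \<le> p (- nprt x)"
      by (simp_all add: p_def dual_pos_part_at_nonneg)
    moreover have "p (pprt x) \<le> norm f * norm x" "p (- nprt x) \<le> norm f * norm x"
      by (intro part; simp add: abs_prts)+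
    ultimately show "norm (h x) \<le> norm x * norm f"
      by (simp add: h_def mult.commute)
  qed
  then obtain g where g: "\<forall>x. dual_apply g x = h x"
    using ex_dual by blast
  have "h x = p x" if "0 \<le> x" for x
    using h_diff[of x 0] that by (simp add: p_def dual_pos_part_at_def)
  thus ?thesis using g unfolding p_def by (intro exI[of _ g]) simp
qed

definition dual_pos_part :: "'a::banach_lattice dual \<Rightarrow> 'a dual"
  where "dual_pos_part f = (SOME g. \<forall>x\<ge>0. dual_apply g x = dual_pos_part_at f x)"

lemma dual_pos_part_apply:
  "0 \<le> x \<Longrightarrow> dual_apply (dual_pos_part f) x = (SUP y\<in>{0..x}. dual_apply f y)"
  using someI_ex[OF ex_dual_pos_part[of f]]
  unfolding dual_pos_part_def dual_pos_part_at_def by blast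

instantiation dual :: (banach_lattice) banach_lattice
begin

definition sup_dual :: "'a dual \<Rightarrow> 'a dual \<Rightarrow> 'a dual"
  where "sup_dual f g = f + dual_pos_part (g - f)"
definition inf_dual :: "'a dual \<Rightarrow> 'a dual \<Rightarrow> 'a dual"
  where "inf_dual f g = - sup (- f) (- g)"
definition abs_dual :: "'a dual \<Rightarrow> 'a dual"
  where "abs_dual f = sup f (- f)"

instance
proof
  have pp: "dual_apply (dual_pos_part f) x = dual_pos_part_at f x" if "0 \<le> x" for f and x :: 'a
    using that by (simp add: dual_pos_part_apply dual_pos_part_at_def)
  fix f g h :: "'a dual" and r s :: real
  show sup1: "f \<le> sup f g" for f g :: "'a dual"
    by (simp add: less_eq_dual_def sup_dual_def pp dual_pos_part_at_nonneg)
  show sup2: "g \<le> sup f g" for f g :: "'a dual"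
    unfolding less_eq_dual_def
  proof (intro allI impI)
    fix x :: 'a assume x: "0 \<le> x"
    show "dual_apply g x \<le> dual_apply (sup f g) x"
      using dual_pos_part_at_upper[OF x order_refl, of "g - f"] x by (simp add: sup_dual_def pp)
  qed
  show sup3: "sup g h \<le> f" if "g \<le> f" "h \<le> f" for f g h :: "'a dual"
    unfolding less_eq_dual_def
  proof (intro allI impI)
    fix x :: 'a assume x: "0 \<le> x"
    have "dual_pos_part_at (h - g) x \<le> dual_apply f x - dual_apply g x"
    proof (rule dual_pos_part_at_least[OF x])
      fix y assume y: "0 \<le> y" "y \<le> x"
      have "dual_apply h y \<le> dual_apply f y" using that y by (simp add: less_eq_dual_def)
      moreover have "dual_apply g (x - y) \<le> dual_apply f (x - y)"
        using that y unfolding less_eq_dual_def by (metis diff_ge_0_iff_ge)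
      ultimately show "dual_apply (h - g) y \<le> dual_apply f x - dual_apply g x" by simp
    qed
    thus "dual_apply (sup g h) x \<le> dual_apply f x" using x by (simp add: sup_dual_def pp)
  qed
  have neg: "- f \<le> - g \<longleftrightarrow> g \<le> f" for f g :: "'a dual"
    by (simp add: less_eq_dual_def)
  have neg': "- f \<le> g \<longleftrightarrow> - g \<le> f" for f g :: "'a dual"
    using neg[of f "- g"] by simp
  show "inf f g \<le> f" "inf f g \<le> g"
    unfolding inf_dual_def by (subst neg', rule sup1 sup2)+
  show "f \<le> inf g h" if "f \<le> g" "f \<le> h"
  proof -
    have "sup (- g) (- h) \<le> - f" using that by (intro sup3) (simp_all add: neg)
    thus ?thesis using neg[of "- f" "sup (- g) (- h)"] by (simp add: inf_dual_def)
  qed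
  show "f \<le> g \<Longrightarrow> h + f \<le> h + g" by (simp add: less_eq_dual_def)
  show "f \<le> g \<Longrightarrow> 0 \<le> r \<Longrightarrow> r *\<^sub>R f \<le> r *\<^sub>R g"
    by (simp add: less_eq_dual_def mult_left_mono)
  show "r \<le> s \<Longrightarrow> 0 \<le> f \<Longrightarrow> r *\<^sub>R f \<le> s *\<^sub>R f"
    by (simp add: less_eq_dual_def mult_right_mono)
  show "\<bar>f\<bar> = sup f (- f)" by (rule abs_dual_def)
  show "norm f \<le> norm g" if "\<bar>f\<bar> \<le> \<bar>g\<bar>"
  proof (rule norm_dual_le)
    fix x :: 'a
    have pos: "\<bar>dual_apply f z\<bar> \<le> dual_apply \<bar>f\<bar> z" if "0 \<le> z" for z
      using sup1[of f "- f"] sup2[of "- f" f] that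
      by (auto simp: abs_dual_def less_eq_dual_def abs_le_iff)
    have dec: "x = pprt x - (- nprt x)" "\<bar>x\<bar> = pprt x + (- nprt x)"
      using prts[of x] by (simp_all add: abs_prts)
    have "\<bar>dual_apply f x\<bar> = \<bar>dual_apply f (pprt x) - dual_apply f (- nprt x)\<bar>"
      by (subst dec(1)) (simp only: dual_apply_diff_right)
    also have "\<dots> \<le> \<bar>dual_apply f (pprt x)\<bar> + \<bar>dual_apply f (- nprt x)\<bar>"
      by simp
    also have "\<dots> \<le> dual_apply \<bar>f\<bar> (pprt x) + dual_apply \<bar>f\<bar> (- nprt x)"
      by (intro add_mono pos) simp_all
    also have "\<dots> = dual_apply \<bar>f\<bar> \<bar>x\<bar>"
      by (subst dec(2)) (simp only: dual_apply_add_right)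
    also have "\<dots> \<le> dual_apply \<bar>g\<bar> \<bar>x\<bar>"
      using that by (simp add: less_eq_dual_def)
    also have "\<dots> = dual_apply g \<bar>x\<bar> + dual_pos_part_at (- g - g) \<bar>x\<bar>"
      by (simp add: abs_dual_def sup_dual_def pp)
    also have "\<dots> \<le> norm g * norm x"
    proof -
      have "dual_pos_part_at (- g - g) \<bar>x\<bar> \<le> norm g * norm x - dual_apply g \<bar>x\<bar>"
      proof (rule dual_pos_part_at_least)
        fix y assume y: "0 \<le> y" "y \<le> \<bar>x\<bar>"
        define w where "w = \<bar>x\<bar> - y - y"
        have "w \<le> \<bar>x\<bar>" using y by (simp add: w_def algebra_simps add_nonneg_nonneg)
        moreover have "- w \<le> \<bar>x\<bar>"
        proof -
          have "y + y \<le> \<bar>x\<bar> + \<bar>x\<bar>" using y by (intro add_mono)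
          thus ?thesis by (simp add: w_def algebra_simps)
        qed
        ultimately have "\<bar>w\<bar> \<le> \<bar>x\<bar>" by (simp add: abs_le_iff)
        hence "norm w \<le> norm x" by (rule norm_mono_abs)
        hence "norm g * norm w \<le> norm g * norm x" by (rule mult_left_mono) simp
        hence "dual_apply g w \<le> norm g * norm x" using norm_dual_bound[of g w] by linarith
        thus "dual_apply (- g - g) y \<le> norm g * norm x - dual_apply g \<bar>x\<bar>"
          by (simp add: w_def)
      qed simp
      thus ?thesis by simp
    qed
    finally show "\<bar>dual_apply f x\<bar> \<le> norm g * norm x" .
  qed simp
qed

end

section \<open>Disjoint and weakly null sequences, almost Dunford--Pettis sets\<close>

definition disjoint_seq :: "(nat \<Rightarrow> 'a::banach_lattice) \<Rightarrow> bool"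
  where "disjoint_seq x \<longleftrightarrow> (\<forall>m n. m \<noteq> n \<longrightarrow> inf \<bar>x m\<bar> \<bar>x n\<bar> = 0)"

definition weakly_null :: "(nat \<Rightarrow> 'a::real_normed_vector) \<Rightarrow> bool"
  where "weakly_null x \<longleftrightarrow> (\<forall>\<phi>. (\<lambda>n. dual_apply \<phi> (x n)) \<longlonglongrightarrow> 0)"

text \<open>
  The type argument stands for the space itself, as in \<open>TYPE('a dual)\<close>.
\<close>

definition weakly_seq_continuous_lattice_ops :: "'a::banach_lattice itself \<Rightarrow> bool"
  where "weakly_seq_continuous_lattice_ops (_ :: 'a itself) \<longleftrightarrow>
    (\<forall>x :: nat \<Rightarrow> 'a. weakly_null x \<longrightarrow> weakly_null (\<lambda>n. \<bar>x n\<bar>))"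

definition solid :: "'a::banach_lattice set \<Rightarrow> bool"
  where "solid A \<longleftrightarrow> (\<forall>x. \<forall>y\<in>A. \<bar>x\<bar> \<le> \<bar>y\<bar> \<longrightarrow> x \<in> A)"

text \<open>
  The suprema \<open>sup {\<bar>f\<^sub>n(a)\<bar> | a \<in> A}\<close> are meant to be real numbers. Applied to the disjoint weakly
  null sequences \<open>(f, 0, 0, \<dots>)\<close>, this forces \<open>A\<close> to be weakly bounded and hence norm bounded;
  conversely they are finite if \<open>A\<close> is norm bounded. Norm boundedness is therefore listed
  explicitly, since \<^const>\<open>uniform_limit\<close> alone only makes these suprema finite eventually.
\<close>

definition almost_Dunford_Pettis :: "'a::banach_lattice set \<Rightarrow> bool"
  where "almost_Dunford_Pettis A \<longleftrightarrow> bounded A \<and>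
    (\<forall>f :: nat \<Rightarrow> 'a dual. disjoint_seq f \<and> weakly_null f \<longrightarrow>
      uniform_limit A (\<lambda>n. dual_apply (f n)) (\<lambda>_. 0) sequentially)"

end

theory Submission
  imports Defs
begin

text \<open>
  Let \<open>f\<^sub>n\<close> be disjoint and weakly null in \<open>F\<^sup>*\<close>. The adjoint images \<open>T\<^sup>*f\<^sub>n\<close> are weakly null,
  hence so are \<open>g\<^sub>n = \<bar>T\<^sup>*f\<^sub>n\<bar>\<close>. If \<open>g\<^sub>n\<close> does not converge to \<open>0\<close> uniformly on the solid set \<open>A\<close>,
  there are, after passing to a subsequence, positive \<open>a\<^sub>n \<in> A\<close> with \<open>g\<^sub>n(a\<^sub>n) \<ge> \<epsilon>\<close>. Since
  \<open>g\<^sub>n \<rightarrow> 0\<close> pointwise, a further subsequence allows \<open>a\<^sub>n\<close> to be replaced by disjoint \<open>0 \<le> v\<^sub>n \<le> a\<^sub>n\<close>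
  with \<open>g\<^sub>n(v\<^sub>n) \<ge> \<epsilon>/2\<close>. The restrictions \<open>h\<^sub>n\<close> of \<open>g\<^sub>n\<close> to the bands generated by the \<open>v\<^sub>n\<close>
  satisfy \<open>0 \<le> h\<^sub>n \<le> g\<^sub>n\<close> and \<open>h\<^sub>n(v\<^sub>n) = g\<^sub>n(v\<^sub>n)\<close>; they are disjoint and weakly null, so \<open>A\<close>
  is not almost Dunford--Pettis.
\<close>

section \<open>Banach lattices\<close>

text \<open>Whenever \<open>z n\<close> is positive, the negative part of \<open>x\<close> is
  dominated in modulus by \<open>z n - x\<close>. Monotonicity of the norm then squeezes it to
  0.\<close>

lemma nonneg_lim:
  fixes x :: "'a::banach_lattice"
  assumes lim: "z \<longlonglongrightarrow> x" and nonneg: "\<forall>\<^sub>F n in sequentially. 0 \<le> z n"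
  shows "0 \<le> x"
proof -
  have bound: "norm (nprt x) \<le> norm (z n - x)" if "0 \<le> z n" for n
  proof (rule norm_mono_abs)
    have "- x \<le> z n - x" using that by simp
    also have "\<dots> \<le> \<bar>z n - x\<bar>" by (rule abs_ge_self)
    finally have "- \<bar>z n - x\<bar> \<le> nprt x" by (simp add: nprt_def minus_le_iff)
    thus "\<bar>nprt x\<bar> \<le> \<bar>z n - x\<bar>" by (simp add: abs_of_nonpos minus_le_iff)
  qed
  have "(\<lambda>n. norm (z n - x)) \<longlonglongrightarrow> 0"
    using lim by (simp add: LIM_zero tendsto_norm_zero)
  moreover have "\<forall>\<^sub>F n in sequentially. norm (nprt x) \<le> norm (z n - x)"
    using nonneg by (rule eventually_mono) (rule bound)
  ultimately have "norm (nprt x) \<le> 0"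
    by (rule tendsto_lowerbound) (rule trivial_limit_sequentially)
  thus ?thesis by (simp add: zero_le_iff_zero_nprt)
qed

lemma sums_ge_term:
  fixes x :: "'a::banach_lattice"
  assumes sums: "w sums x" and nonneg: "\<And>n. 0 \<le> w n"
  shows "w i \<le> x"
proof -
  have "(\<lambda>n. (\<Sum>j<n. w j) - w i) \<longlonglongrightarrow> x - w i"
    using sums unfolding sums_def by (intro tendsto_intros)
  moreover have "\<forall>\<^sub>F n in sequentially. 0 \<le> (\<Sum>j<n. w j) - w i"
    using eventually_gt_at_top[of i]
  proof eventually_elim
    case (elim n)
    have "w i \<le> (\<Sum>j<n. w j)"
      using elim nonneg sum_mono2[of "{..<n}" "{i}" w] by simp
    thus ?case by simp
  qed
  ultimately have "0 \<le> x - w i" by (rule nonneg_lim)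
  thus ?thesis by simp
qed

section \<open>Disjointification of a norm bounded positive sequence\<close>

text \<open>With \<open>w = s - c *\<^sub>R t\<close>, the first argument is the positive part of
  \<open>w\<close>. The second is \<open>inverse c\<close> times the negative part of
  \<open>w\<close>, hence below that negative part because \<open>inverse c \<le> 1\<close>.
  Positive and negative part of \<open>w\<close> are disjoint.\<close>

lemma pprt_disjoint:
  fixes s t :: "'a::banach_lattice"
  assumes "1 \<le> c"
  shows "inf (pprt (s - c *\<^sub>R t)) (pprt (t - inverse c *\<^sub>R s)) = 0"
proof (rule antisym)
  define w where "w = s - c *\<^sub>R t"
  have c: "0 < c" "inverse c \<le> 1" using assms by (simp_all add: inverse_le_1_iff)
  have eq: "t - inverse c *\<^sub>R s = inverse c *\<^sub>R (- w)"
    using c by (simp add: w_def scaleR_diff_right)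
  have "inverse c *\<^sub>R (- w) \<le> inverse c *\<^sub>R (- nprt w)"
    using c by (intro scaleR_left_mono) (simp_all add: nprt_def)
  also have "\<dots> \<le> 1 *\<^sub>R (- nprt w)"
    using c by (intro scaleR_right_mono) simp_all
  finally have le: "pprt (inverse c *\<^sub>R (- w)) \<le> - nprt w"
    by (simp add: pprt_def)
  have "inf (pprt w) (- nprt w) = 0"
  proof -
    \<comment> \<open>Since \<open>pprt w = w + - nprt w\<close>, both entries are translates by
      \<open>- nprt w\<close>, and the infimum of \<open>w\<close> and 0 that remains is
      \<open>nprt w\<close>.\<close>
    have "inf (pprt w) (- nprt w) = inf (w + - nprt w) (0 + - nprt w)"
      using prts[of w] by (metis add.left_neutral add_diff_cancel_right' diff_conv_add_uminus)
    also have "\<dots> = nprt w + - nprt w"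
      by (simp only: nprt_def flip: add_inf_distrib_right)
    finally show ?thesis by simp
  qed
  thus "inf (pprt (s - c *\<^sub>R t)) (pprt (t - inverse c *\<^sub>R s)) \<le> 0"
    unfolding eq w_def[symmetric] using le by (metis inf_mono order_refl)
qed simp

text \<open>The vector \<open>x\<close> is the sum of the series
  \<open>inverse (2 ^ n) *\<^sub>R u n\<close>. For \<open>m < n\<close>, the subtracted finite sum
  puts the term of index \<open>n\<close> below the positive part of
  \<open>u n - 4 ^ n *\<^sub>R u m\<close>. The subtracted multiple of \<open>x\<close> puts the
  term of index \<open>m\<close> below the positive part of
  \<open>u m - inverse (4 ^ n) *\<^sub>R u n\<close>. These bounds are disjoint by
  \<open>pprt_disjoint\<close> with \<open>c = 4 ^ n\<close>.\<close>

lemma disjointify: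
  fixes u :: "nat \<Rightarrow> 'a::banach_lattice"
  assumes nonneg: "\<And>n. 0 \<le> u n" and bounded: "\<And>n. norm (u n) \<le> B"
  obtains x where
    "disjoint_seq (\<lambda>n. pprt (u n - 4 ^ n *\<^sub>R (\<Sum>i<n. u i) - inverse (2 ^ n) *\<^sub>R x))"
    and "0 \<le> x"
proof -
  define w where "w n = inverse (2 ^ n) *\<^sub>R u n" for n
  have "summable (\<lambda>n. B * inverse 2 ^ n)"
    by (intro summable_mult summable_geometric) simp
  hence "summable w"
    by (rule summable_comparison_test')
      (use bounded in \<open>simp add: w_def power_inverse divide_simps\<close>)
  then obtain x where x: "w sums x" by (auto simp: summable_def)
  have w_nonneg: "0 \<le> w n" for n using nonneg by (simp add: w_def scaleR_nonneg_nonneg)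
  have w_le: "w n \<le> x" for n using x w_nonneg by (rule sums_ge_term)
  have x_nonneg: "0 \<le> x" using w_nonneg[of 0] w_le[of 0] by (rule order_trans)
  define v where "v n = pprt (u n - 4 ^ n *\<^sub>R (\<Sum>i<n. u i) - inverse (2 ^ n) *\<^sub>R x)" for n
  have disj: "inf (v n) (v m) = 0" if "m < n" for m n
  proof (rule antisym)
    have "u m \<le> (\<Sum>i<n. u i)"
      using that nonneg sum_mono2[of "{..<n}" "{m}" u] by simp
    hence "4 ^ n *\<^sub>R u m \<le> 4 ^ n *\<^sub>R (\<Sum>i<n. u i)"
      by (intro scaleR_left_mono) simp_all
    moreover have "0 \<le> inverse (2 ^ n) *\<^sub>R x"
      using x_nonneg by (intro scaleR_nonneg_nonneg) simp_all
    ultimately have "4 ^ n *\<^sub>R u m + 0 \<le> 4 ^ n *\<^sub>R (\<Sum>i<n. u i) + inverse (2 ^ n) *\<^sub>R x"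
      by (rule add_mono)
    hence "u n - (4 ^ n *\<^sub>R (\<Sum>i<n. u i) + inverse (2 ^ n) *\<^sub>R x) \<le> u n - 4 ^ n *\<^sub>R u m"
      by (intro diff_left_mono) simp
    hence vn: "v n \<le> pprt (u n - 4 ^ n *\<^sub>R u m)"
      unfolding v_def diff_diff_eq by (rule pprt_mono)
    \<comment> \<open>The later element \<open>u n\<close> is reached through its own term
      \<open>w n\<close> in the series for \<open>x\<close>; \<open>m < n\<close> makes the
      coefficient large enough.\<close>
    have "inverse (4 ^ n) *\<^sub>R u n \<le> (inverse (2 ^ m) * inverse (2 ^ n)) *\<^sub>R u n"
    proof (intro scaleR_right_mono nonneg)
      have "(2::real) ^ m * 2 ^ n \<le> 2 ^ n * 2 ^ n" using that by simp
      also have "\<dots> = 4 ^ n" by (simp flip: power_mult_distrib)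
      finally show "inverse (4 ^ n) \<le> inverse (2 ^ m) * inverse ((2::real) ^ n)"
        by (simp add: le_imp_inverse_le flip: inverse_mult_distrib)
    qed
    also have "\<dots> = inverse (2 ^ m) *\<^sub>R w n" by (simp add: w_def)
    also have "\<dots> \<le> inverse (2 ^ m) *\<^sub>R x" using w_le by (intro scaleR_left_mono) simp_all
    finally have "inverse (4 ^ n) *\<^sub>R u n \<le> inverse (2 ^ m) *\<^sub>R x" .
    moreover have "0 \<le> 4 ^ m *\<^sub>R (\<Sum>i<m. u i)"
      using nonneg by (intro scaleR_nonneg_nonneg sum_nonneg) simp_all
    ultimately have "0 + inverse (4 ^ n) *\<^sub>R u n \<le> 4 ^ m *\<^sub>R (\<Sum>i<m. u i) + inverse (2 ^ m) *\<^sub>R x"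
      by (intro add_mono)
    hence "u m - (4 ^ m *\<^sub>R (\<Sum>i<m. u i) + inverse (2 ^ m) *\<^sub>R x) \<le> u m - inverse (4 ^ n) *\<^sub>R u n"
      by (intro diff_left_mono) simp
    hence vm: "v m \<le> pprt (u m - inverse (4 ^ n) *\<^sub>R u n)"
      unfolding v_def diff_diff_eq by (rule pprt_mono)
    show "inf (v n) (v m) \<le> 0"
      using inf_mono[OF vn vm] pprt_disjoint[of "4 ^ n" "u n" "u m"] by simp
  qed (simp add: v_def)
  have "disjoint_seq v"
    unfolding disjoint_seq_def
  proof (intro allI impI)
    fix m n :: nat assume "m \<noteq> n"
    hence "inf (v m) (v n) = 0"
      using disj[of m n] disj[of n m] by (metis inf.commute nat_neq_iff)
    thus "inf \<bar>v m\<bar> \<bar>v n\<bar> = 0" by (simp add: v_def)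
  qed
  thus ?thesis using that x_nonneg unfolding v_def by blast
qed

section \<open>Functionals on Banach lattices\<close>

lemma dual_nonneg_apply: "0 \<le> f \<Longrightarrow> 0 \<le> x \<Longrightarrow> 0 \<le> dual_apply f x"
  by (simp add: less_eq_dual_def)

lemma dual_apply_mono: "0 \<le> f \<Longrightarrow> x \<le> y \<Longrightarrow> dual_apply f x \<le> dual_apply f y"
  using dual_nonneg_apply[of f "y - x"] by simp

lemma dual_apply_mono_left: "f \<le> g \<Longrightarrow> 0 \<le> x \<Longrightarrow> dual_apply f x \<le> dual_apply g x"
  by (simp add: less_eq_dual_def)

lemma abs_dual_apply_le_pos:
  assumes "0 \<le> x"
  shows "\<bar>dual_apply f x\<bar> \<le> dual_apply \<bar>f\<bar> x"
  using dual_apply_mono_left[OF abs_ge_self assms] dual_apply_mono_left[OF abs_ge_minus_self assms]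
  by (simp add: abs_le_iff)

lemma abs_dual_apply_le: "\<bar>dual_apply f x\<bar> \<le> dual_apply \<bar>f\<bar> \<bar>x\<bar>"
proof -
  have "\<bar>dual_apply f x\<bar> = \<bar>dual_apply f (pprt x) - dual_apply f (- nprt x)\<bar>"
    using arg_cong[OF prts[of x], of "dual_apply f"] by simp
  also have "\<dots> \<le> \<bar>dual_apply f (pprt x)\<bar> + \<bar>dual_apply f (- nprt x)\<bar>"
    by (rule abs_triangle_ineq4)
  also have "\<dots> \<le> dual_apply \<bar>f\<bar> (pprt x) + dual_apply \<bar>f\<bar> (- nprt x)"
    by (intro add_mono abs_dual_apply_le_pos) simp_all
  also have "\<dots> = dual_apply \<bar>f\<bar> \<bar>x\<bar>"
    by (simp add: abs_prts)
  finally show ?thesis .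
qed

text \<open>Kantorovich extension from the positive cone: additivity makes \<open>p u - p v\<close>
  depend only on \<open>u - v\<close>, which yields linearity of the difference of \<open>p\<close>
  at the positive and the negative part. Positivity gives
  \<open>\<bar>h x\<bar> \<le> p \<bar>x\<bar>\<close>, so \<open>bound\<close> makes
  \<open>h\<close> bounded.\<close>

lemma ex_dual_extension:
  fixes p :: "'a::banach_lattice \<Rightarrow> real"
  assumes add: "\<And>x y. 0 \<le> x \<Longrightarrow> 0 \<le> y \<Longrightarrow> p (x + y) = p x + p y"
    and scale: "\<And>r x. 0 \<le> r \<Longrightarrow> 0 \<le> x \<Longrightarrow> p (r *\<^sub>R x) = r * p x"
    and nonneg: "\<And>x. 0 \<le> x \<Longrightarrow> 0 \<le> p x"
    and bound: "\<And>x. 0 \<le> x \<Longrightarrow> p x \<le> C * norm x"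
  shows "\<exists>h. \<forall>x\<ge>0. dual_apply h x = p x"
proof -
  define h where "h x = p (pprt x) - p (- nprt x)" for x
  have h_diff: "h (u - v) = p u - p v" if "0 \<le> u" "0 \<le> v" for u v
  proof -
    have "u + - nprt (u - v) = v + pprt (u - v)"
      using prts[of "u - v"] by (simp add: algebra_simps)
    hence "p u + p (- nprt (u - v)) = p v + p (pprt (u - v))"
      using that by (metis add neg_0_le_iff_le nprt_le_zero zero_le_pprt)
    thus ?thesis by (simp add: h_def)
  qed
  have dec: "x = pprt x - (- nprt x)" for x :: 'a
    using prts[of x] by simp
  have h_pos: "h x = p x" if "0 \<le> x" for x
    using h_diff[OF that order_refl] scale[of 0 0] by simp
  have "bounded_linear h"
  proof (rule bounded_linear_intro)
    fix x y :: 'a and r :: real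
    have "x + y = (pprt x + pprt y) - (- nprt x + - nprt y)"
      by (subst dec[of x], subst dec[of y]) (simp add: algebra_simps)
    hence "h (x + y) = p (pprt x + pprt y) - p (- nprt x + - nprt y)"
      by (simp only:) (rule h_diff; intro add_nonneg_nonneg; simp)
    also have "\<dots> = h x + h y"
      by (subst (1 2) add) (simp_all add: h_def)
    finally show "h (x + y) = h x + h y" .
    have pos: "h (r *\<^sub>R x) = r * h x" if "0 \<le> r" for r x
    proof -
      have "r *\<^sub>R x = r *\<^sub>R pprt x - r *\<^sub>R (- nprt x)"
        by (subst dec) (simp only: scaleR_diff_right)
      moreover have "0 \<le> r *\<^sub>R pprt x" "0 \<le> r *\<^sub>R (- nprt x)"
        using that by (intro scaleR_nonneg_nonneg; simp)+
      ultimately have "h (r *\<^sub>R x) = p (r *\<^sub>R pprt x) - p (r *\<^sub>R (- nprt x))"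
        using h_diff by metis
      also have "\<dots> = r * p (pprt x) - r * p (- nprt x)"
        by (subst (1 2) scale) (use that in simp_all)
      finally show ?thesis by (simp add: h_def right_diff_distrib)
    qed
    show "h (r *\<^sub>R x) = r *\<^sub>R h x"
    proof (cases "0 \<le> r")
      case True
      thus ?thesis by (simp add: pos)
    next
      case False
      have "h (- x) = - h x"
        by (simp add: h_def pprt_neg nprt_neg)
      moreover have "h ((- r) *\<^sub>R (- x)) = (- r) * h (- x)" using False by (intro pos) simp
      ultimately show ?thesis by simp
    qed
    have "h x \<le> p \<bar>x\<bar>" "- h x \<le> p \<bar>x\<bar>"
      using nonneg[of "pprt x"] nonneg[of "- nprt x"] add[of "pprt x" "- nprt x"]
      by (simp_all add: h_def abs_prts)
    thus "norm (h x) \<le> norm x * C"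
      using bound[of "\<bar>x\<bar>"] by (simp add: mult.commute)
  qed
  then obtain g where "\<forall>x. dual_apply g x = h x"
    using ex_dual by blast
  thus ?thesis using h_pos by (intro exI[of _ g]) simp
qed

section \<open>Restriction of a positive functional to a principal ideal\<close>

text \<open>
  For \<open>y \<ge> 0\<close>, this is the set of all \<open>z \<in> [0, x]\<close> in the ideal generated by \<open>y\<close>.
\<close>

definition ideal_below :: "'a::banach_lattice \<Rightarrow> 'a \<Rightarrow> 'a set"
  where "ideal_below y x = {z. 0 \<le> z \<and> z \<le> x \<and> (\<exists>k. z \<le> k *\<^sub>R y)}"

lemma zero_in_ideal_below: "0 \<le> x \<Longrightarrow> 0 \<in> ideal_below y x"
  by (auto simp: ideal_below_def intro: exI[of _ 0])

text \<open>The supremum is finite because positivity of \<open>g\<close> bounds it by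
  \<open>dual_apply g x\<close>. Additivity rests on Riesz decomposition: \<open>z\<close> below
  \<open>x + x'\<close> splits into \<open>inf z x\<close> and the rest, and both pieces are below
  \<open>z\<close>, so they satisfy the same ideal bound. Conversely, the ideal is closed under
  sums.\<close>

lemma ex_dual_restriction:
  fixes g :: "'a::banach_lattice dual"
  assumes g: "0 \<le> g"
  shows "\<exists>h. \<forall>x\<ge>0. dual_apply h x = (SUP z\<in>ideal_below y x. dual_apply g z)"
proof (rule ex_dual_extension)
  define p where "p x = (SUP z\<in>ideal_below y x. dual_apply g z)" for x
  have upper: "dual_apply g z \<le> p x" if "z \<in> ideal_below y x" for x z
    unfolding p_def using that g
    by (intro cSUP_upper bdd_aboveI2[of _ _ "dual_apply g x"])
      (auto simp: ideal_below_def intro: dual_apply_mono)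
  have least: "p x \<le> c" if "0 \<le> x" "\<And>z. z \<in> ideal_below y x \<Longrightarrow> dual_apply g z \<le> c" for x c
    unfolding p_def using that zero_in_ideal_below by (intro cSUP_least) auto
  show nonneg: "0 \<le> p x" if "0 \<le> x" for x
    using upper[OF zero_in_ideal_below[OF that]] by simp
  show "p x \<le> norm g * norm x" if "0 \<le> x" for x
  proof (rule least[OF that])
    fix z assume "z \<in> ideal_below y x"
    hence "dual_apply g z \<le> dual_apply g x"
      using g by (auto simp: ideal_below_def intro: dual_apply_mono)
    also have "\<dots> \<le> norm g * norm x" using norm_dual_bound[of g x] by simp
    finally show "dual_apply g z \<le> norm g * norm x" .
  qed
  show "p (x + x') = p x + p x'" if x: "0 \<le> x" "0 \<le> x'" for x x'
  proof (rule antisym)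
    show "p (x + x') \<le> p x + p x'"
    proof (rule least)
      fix z assume "z \<in> ideal_below y (x + x')"
      then obtain k where z: "0 \<le> z" "z \<le> x + x'" "z \<le> k *\<^sub>R y" by (auto simp: ideal_below_def)
      define z1 where "z1 = inf z x"
      have z1: "0 \<le> z1" "z1 \<le> x" "z1 \<le> z" using x z by (simp_all add: z1_def)
      have "z - x' \<le> z1" using x z by (simp add: z1_def diff_le_eq)
      hence "z - z1 \<le> x'" by (simp add: algebra_simps)
      moreover have "z - z1 \<le> k *\<^sub>R y" using z z1 by (metis diff_le_eq add_increasing2 order_trans)
      ultimately have "dual_apply g (z - z1) \<le> p x'"
        using z1 by (intro upper) (auto simp: ideal_below_def)
      moreover have "dual_apply g z1 \<le> p x"
        using z z1 by (intro upper) (auto simp: ideal_below_def intro: order_trans)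
      ultimately show "dual_apply g z \<le> p x + p x'" by simp
    qed (use x in simp)
    have "p x \<le> p (x + x') - p x'"
    proof (rule least)
      fix z assume z: "z \<in> ideal_below y x"
      have "p x' \<le> p (x + x') - dual_apply g z"
      proof (rule least)
        fix z' assume z': "z' \<in> ideal_below y x'"
        have "\<exists>k. z + z' \<le> k *\<^sub>R y"
          using z z' by (auto simp: ideal_below_def) (metis add_mono scaleR_add_left)
        hence "z + z' \<in> ideal_below y (x + x')"
          using z z' by (auto simp: ideal_below_def intro: add_mono)
        from upper[OF this] show "dual_apply g z' \<le> p (x + x') - dual_apply g z" by simp
      qed (use x in simp)
      thus "dual_apply g z \<le> p (x + x') - p x'" by simp
    qed (use x in simp)
    thus "p x + p x' \<le> p (x + x')" by simp
  qed
  have scale_le: "p (r *\<^sub>R x) \<le> r * p x" if r: "0 < r" and x: "0 \<le> x" for r x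
  proof (rule least)
    fix z assume "z \<in> ideal_below y (r *\<^sub>R x)"
    then obtain k where z: "0 \<le> z" "z \<le> r *\<^sub>R x" "z \<le> k *\<^sub>R y" by (auto simp: ideal_below_def)
    have "inverse r *\<^sub>R z \<le> inverse r *\<^sub>R (r *\<^sub>R x)" "inverse r *\<^sub>R z \<le> inverse r *\<^sub>R (k *\<^sub>R y)"
      using r z by (intro scaleR_left_mono; simp)+
    hence "inverse r *\<^sub>R z \<in> ideal_below y x"
      using r z by (auto simp: ideal_below_def scaleR_nonneg_nonneg)
    from upper[OF this] show "dual_apply g z \<le> r * p x"
      using r by (simp add: field_simps)
  qed (use r x in \<open>simp add: scaleR_nonneg_nonneg\<close>)
  show "p (r *\<^sub>R x) = r * p x" if r: "0 \<le> r" and x: "0 \<le> x" for r x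
  proof (cases "r = 0")
    case True
    \<comment> \<open>Only 0 lies in \<open>ideal_below y 0\<close>. This case is separate because
      \<open>scale_le\<close> divides by the scalar.\<close>
    have "p 0 \<le> 0" by (rule least) (auto simp: ideal_below_def)
    thus ?thesis using True nonneg[of 0] by simp
  next
    case False
    hence r: "0 < r" using r by simp
    \<comment> \<open>The reverse inequality is \<open>scale_le\<close> for the scalar
      \<open>inverse r\<close> at the vector \<open>r *\<^sub>R x\<close>.\<close>
    have "p (inverse r *\<^sub>R (r *\<^sub>R x)) \<le> inverse r * p (r *\<^sub>R x)"
      using r x by (intro scale_le scaleR_nonneg_nonneg) simp_all
    hence "r * p x \<le> p (r *\<^sub>R x)" using r by (simp add: field_simps)
    thus ?thesis using scale_le[OF r x] by simp
  qed
qed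

text \<open>For positive \<open>g\<close> and \<open>y\<close> this is the least positive functional
  that agrees with \<open>g\<close> on the ideal generated by \<open>y\<close>. The choice is
  unique, since a functional is determined by its values on the positive cone.\<close>

definition dual_restriction :: "'a::banach_lattice dual \<Rightarrow> 'a \<Rightarrow> 'a dual"
  where "dual_restriction g y =
    (SOME h. \<forall>x\<ge>0. dual_apply h x = (SUP z\<in>ideal_below y x. dual_apply g z))"

context
  fixes g :: "'a::banach_lattice dual"
  assumes g: "0 \<le> g"
begin

lemma dual_restriction_apply:
  "0 \<le> x \<Longrightarrow> dual_apply (dual_restriction g y) x = (SUP z\<in>ideal_below y x. dual_apply g z)"
  using someI_ex[OF ex_dual_restriction[OF g, of y]] unfolding dual_restriction_def by blast

lemma dual_restriction_upper:
  assumes "z \<in> ideal_below y x"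
  shows "dual_apply g z \<le> dual_apply (dual_restriction g y) x"
proof -
  have "0 \<le> x" using assms by (auto simp: ideal_below_def)
  thus ?thesis
    using assms g by (subst dual_restriction_apply)
      (auto simp: ideal_below_def intro!: cSUP_upper bdd_aboveI2[of _ _ "dual_apply g x"] dual_apply_mono)
qed

lemma dual_restriction_least:
  assumes "0 \<le> x" "\<And>z. z \<in> ideal_below y x \<Longrightarrow> dual_apply g z \<le> c"
  shows "dual_apply (dual_restriction g y) x \<le> c"
  using assms zero_in_ideal_below by (subst dual_restriction_apply) (auto intro!: cSUP_least)

lemma dual_restriction_nonneg: "0 \<le> dual_restriction g y"
  unfolding less_eq_dual_def using dual_restriction_upper[OF zero_in_ideal_below] by simp

lemma dual_restriction_le: "dual_restriction g y \<le> g"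
  unfolding less_eq_dual_def
  by (auto simp: ideal_below_def intro!: dual_restriction_least dual_apply_mono[OF g])

lemma dual_restriction_self:
  assumes "0 \<le> y"
  shows "dual_apply (dual_restriction g y) y = dual_apply g y"
proof (rule antisym)
  have "y \<in> ideal_below y y"
    using assms by (auto simp: ideal_below_def intro: exI[of _ 1])
  thus "dual_apply g y \<le> dual_apply (dual_restriction g y) y"
    by (rule dual_restriction_upper)
qed (rule dual_apply_mono_left[OF dual_restriction_le assms])

end

text \<open>A positive element below multiples of both \<open>y\<close> and \<open>y'\<close> is 0,
  so the second restriction vanishes on the positive part of the ideal of \<open>y\<close>. The
  infimum \<open>f\<close> is therefore at most 0 there, and since the first restriction is a
  supremum over that ideal, this propagates to the whole positive cone.\<close>

lemma dual_restriction_disjoint: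
  fixes y y' :: "'a::banach_lattice"
  assumes g: "0 \<le> g" and g': "0 \<le> g'" and y: "0 \<le> y" "0 \<le> y'" "inf y y' = 0"
  shows "inf (dual_restriction g y) (dual_restriction g' y') = 0"
proof (rule antisym)
  let ?h = "dual_restriction g y" and ?h' = "dual_restriction g' y'"
  define f where "f = inf ?h ?h'"
  have f: "f \<le> ?h" "f \<le> ?h'" by (simp_all add: f_def)
  have vanish: "dual_apply ?h' z \<le> 0" if z: "z \<in> ideal_below y x" for x z
  proof (rule dual_restriction_least[OF g'])
    from z obtain k where zk: "z \<le> k *\<^sub>R y" by (auto simp: ideal_below_def)
    fix w assume "w \<in> ideal_below y' z"
    then obtain k' where w: "0 \<le> w" "w \<le> z" "w \<le> k' *\<^sub>R y'" by (auto simp: ideal_below_def)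
    \<comment> \<open>A common positive multiplier, so that \<open>inverse K *\<^sub>R w\<close>
      lies below both \<open>y\<close> and \<open>y'\<close>.\<close>
    define K where "K = max 1 (max k k')"
    have K: "0 < K" by (simp add: K_def)
    have "w \<le> k *\<^sub>R y" using w zk by (blast intro: order_trans)
    also have "\<dots> \<le> K *\<^sub>R y" using y by (intro scaleR_right_mono) (simp_all add: K_def)
    finally have "inverse K *\<^sub>R w \<le> inverse K *\<^sub>R (K *\<^sub>R y)"
      using K by (intro scaleR_left_mono) simp_all
    moreover have "w \<le> K *\<^sub>R y'"
      using w(3) by (rule order_trans) (use y in \<open>intro scaleR_right_mono, simp_all add: K_def\<close>)
    hence "inverse K *\<^sub>R w \<le> inverse K *\<^sub>R (K *\<^sub>R y')"
      using K by (intro scaleR_left_mono) simp_all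
    ultimately have "inverse K *\<^sub>R w \<le> inf y y'" using K by simp
    hence "dual_apply g' (inverse K *\<^sub>R w) \<le> 0"
      using dual_apply_mono[OF g', of _ 0] y by (metis dual_apply_zero_right)
    thus "dual_apply g' w \<le> 0" using K by (simp add: mult_le_0_iff)
  qed (use z in \<open>simp add: ideal_below_def\<close>)
  have "dual_apply f x \<le> 0" if x: "0 \<le> x" for x
  proof -
    \<comment> \<open>Splitting \<open>x\<close> into \<open>z\<close> and \<open>x - z\<close>,
      with \<open>f\<close> at most 0 at \<open>z\<close> and at most \<open>?h\<close> at
      \<open>x - z\<close>, shows that subtracting \<open>f\<close> does not destroy the upper bound
      defining \<open>?h\<close>.\<close>
    have "dual_apply ?h x \<le> dual_apply ?h x - dual_apply f x"
    proof (rule dual_restriction_least[OF g x])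
      fix z assume z: "z \<in> ideal_below y x"
      hence z': "0 \<le> z" "z \<le> x" by (auto simp: ideal_below_def)
      have "dual_apply f z \<le> 0"
        using dual_apply_mono_left[OF f(2) z'(1)] vanish[OF z] by simp
      moreover have "dual_apply f (x - z) \<le> dual_apply ?h (x - z)"
        using z' by (intro dual_apply_mono_left f) simp
      moreover have "dual_apply g z \<le> dual_apply ?h z"
        using z by (intro dual_restriction_upper g) (auto simp: ideal_below_def)
      ultimately show "dual_apply g z \<le> dual_apply ?h x - dual_apply f x" by simp
    qed
    thus ?thesis by simp
  qed
  thus "inf ?h ?h' \<le> 0" unfolding f_def[symmetric] by (simp add: less_eq_dual_def)
qed (simp add: dual_restriction_nonneg g g')

section \<open>Weakly null sequences\<close>

text \<open>A functional and its modulus satisfy \<open>\<bar>\<phi>(x n)\<bar> \<le>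
  \<bar>\<phi>\<bar>(x n) \<le> \<bar>\<phi>\<bar>(y n)\<close>. This carries weak nullity from
  positive functionals to their restrictions.\<close>

lemma weakly_null_dominated:
  fixes x y :: "nat \<Rightarrow> 'a::banach_lattice"
  assumes y: "weakly_null y" and x: "\<And>n. 0 \<le> x n" "\<And>n. x n \<le> y n"
  shows "weakly_null x"
  unfolding weakly_null_def
proof
  fix \<phi> :: "'a dual"
  have lim: "(\<lambda>n. dual_apply \<bar>\<phi>\<bar> (y n)) \<longlonglongrightarrow> 0"
    using y by (simp add: weakly_null_def)
  have "norm (dual_apply \<phi> (x n)) \<le> dual_apply \<bar>\<phi>\<bar> (y n)" for n
    using abs_dual_apply_le_pos[OF x(1)[of n], of \<phi>] dual_apply_mono[of "\<bar>\<phi>\<bar>", OF _ x(2)[of n]]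
    by simp
  thus "(\<lambda>n. dual_apply \<phi> (x n)) \<longlonglongrightarrow> 0"
    by (intro Lim_null_comparison[OF _ lim] always_eventually allI)
qed

lemma weakly_null_subseq:
  assumes x: "weakly_null x" and k: "strict_mono k"
  shows "weakly_null (\<lambda>n. x (k n))"
  unfolding weakly_null_def
proof
  fix \<phi> show "(\<lambda>n. dual_apply \<phi> (x (k n))) \<longlonglongrightarrow> 0"
    using LIMSEQ_subseq_LIMSEQ[OF _ k, of "\<lambda>n. dual_apply \<phi> (x n)" 0] x
    by (simp add: weakly_null_def comp_def)
qed

lemma weakly_null_image:
  assumes S: "bounded_linear S" and x: "weakly_null x"
  shows "weakly_null (\<lambda>n. S (x n))"
  unfolding weakly_null_def
proof
  fix \<phi>
  obtain \<psi> where \<psi>: "\<forall>y. dual_apply \<psi> y = dual_apply \<phi> (S y)"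
    using ex_dual[OF bounded_linear_compose[OF bounded_linear_dual_apply[of \<phi>] S]] by blast
  have "(\<lambda>n. dual_apply \<psi> (x n)) \<longlonglongrightarrow> 0"
    using x by (simp add: weakly_null_def)
  thus "(\<lambda>n. dual_apply \<phi> (S (x n))) \<longlonglongrightarrow> 0"
    by (simp add: \<psi>)
qed

text \<open>Evaluation at \<open>x\<close> is a bounded functional on the dual, hence among the
  functionals that test weak convergence.\<close>

lemma weakly_null_dual_pointwise:
  assumes f: "weakly_null f"
  shows "(\<lambda>n. dual_apply (f n) x) \<longlonglongrightarrow> 0"
proof -
  have "bounded_linear (\<lambda>f. dual_apply f x)"
    by (rule bounded_linear_intro[of _ "norm x"]) (simp_all add: norm_dual_bound)
  then obtain \<phi> where \<phi>: "\<forall>f. dual_apply \<phi> f = dual_apply f x"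
    using ex_dual by blast
  have "(\<lambda>n. dual_apply \<phi> (f n)) \<longlonglongrightarrow> 0"
    using f by (simp add: weakly_null_def)
  thus ?thesis by (simp add: \<phi>)
qed

lemma ex_adjoint:
  fixes T :: "'a::real_normed_vector \<Rightarrow> 'b::real_normed_vector"
  assumes T: "bounded_linear T"
  obtains S where "bounded_linear S" "\<And>f x. dual_apply (S f) x = dual_apply f (T x)"
proof -
  have "\<exists>g. \<forall>x. dual_apply g x = dual_apply f (T x)" for f
    by (intro ex_dual bounded_linear_compose[OF bounded_linear_dual_apply T])
  then obtain S where S: "\<And>f x. dual_apply (S f) x = dual_apply f (T x)" by metis
  obtain K where K: "0 \<le> K" "\<And>x. norm (T x) \<le> norm x * K"
    using bounded_linear.nonneg_bounded[OF T] by auto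
  have "bounded_linear S"
  proof (rule bounded_linear_intro)
    fix f show "norm (S f) \<le> norm f * K"
    proof (rule norm_dual_le)
      fix x
      have "\<bar>dual_apply f (T x)\<bar> \<le> norm f * norm (T x)" by (rule norm_dual_bound)
      also have "\<dots> \<le> norm f * (norm x * K)" by (intro mult_left_mono K) simp
      finally show "\<bar>dual_apply (S f) x\<bar> \<le> norm f * K * norm x" by (simp add: S mult_ac)
    qed (use K in simp)
  qed (rule dual_eqI, simp add: S)+
  thus ?thesis using S that by blast
qed

section \<open>Uniform convergence on solid almost Dunford--Pettis sets\<close>

text \<open>Suppose all the values are at least \<open>\<epsilon>\<close>. Under \<open>g n\<close>,
  disjointification costs at most \<open>\<epsilon> / 4\<close> for the finite sum, by
  \<open>small\<close>, and eventually less than \<open>\<epsilon> / 4\<close> for the multiple of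
  \<open>x\<close>, by pointwise convergence. The disjoint \<open>v n\<close>, in \<open>A\<close>
  by solidity, thus keep \<open>\<epsilon> / 2\<close>, against the uniform convergence of the
  restrictions \<open>h n\<close> on \<open>A\<close>.\<close>

lemma almost_Dunford_Pettis_diagonal:
  fixes g :: "nat \<Rightarrow> 'e::banach_lattice dual"
  assumes A: "almost_Dunford_Pettis A" "solid A"
    and g: "weakly_null g" "\<And>n. 0 \<le> g n"
    and a: "\<And>n. a n \<in> A" "\<And>n. 0 \<le> a n"
    and small: "\<And>n. 4 ^ n * dual_apply (g n) (\<Sum>i<n. a i) \<le> \<epsilon> / 4"
    and \<epsilon>: "0 < \<epsilon>"
  shows "\<exists>n. dual_apply (g n) (a n) < \<epsilon>"
proof (rule ccontr)
  assume "\<not> ?thesis"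
  hence large: "\<epsilon> \<le> dual_apply (g n) (a n)" for n by (simp add: not_less)
  obtain B where "\<And>n. norm (a n) \<le> B"
    using A(1) a(1) by (auto simp: almost_Dunford_Pettis_def bounded_iff)
  with a(2) obtain x where disj:
      "disjoint_seq (\<lambda>n. pprt (a n - 4 ^ n *\<^sub>R (\<Sum>i<n. a i) - inverse (2 ^ n) *\<^sub>R x))"
    and x: "0 \<le> x"
    using disjointify[of a B] by blast
  define v where "v n = pprt (a n - 4 ^ n *\<^sub>R (\<Sum>i<n. a i) - inverse (2 ^ n) *\<^sub>R x)" for n
  define h where "h n = dual_restriction (g n) (v n)" for n
  have v_nonneg: "0 \<le> v n" for n by (simp add: v_def)
  have v_A: "v n \<in> A" for n
  proof -
    have "0 \<le> 4 ^ n *\<^sub>R (\<Sum>i<n. a i) + inverse (2 ^ n) *\<^sub>R x"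
      using a(2) x by (intro add_nonneg_nonneg scaleR_nonneg_nonneg sum_nonneg) simp_all
    hence "a n - 4 ^ n *\<^sub>R (\<Sum>i<n. a i) - inverse (2 ^ n) *\<^sub>R x \<le> a n"
      by (metis diff_diff_eq diff_left_mono diff_zero)
    hence "v n \<le> a n" using a(2) by (simp add: v_def pprt_def)
    hence "\<bar>v n\<bar> \<le> \<bar>a n\<bar>" using v_nonneg a(2) by simp
    thus ?thesis using A(2) a(1) unfolding solid_def by blast
  qed
  have "disjoint_seq h"
    unfolding disjoint_seq_def
  proof (intro allI impI)
    fix m n :: nat assume "m \<noteq> n"
    hence "inf (v m) (v n) = 0"
      using disj v_nonneg unfolding disjoint_seq_def v_def[symmetric] by simp
    hence "inf (h m) (h n) = 0"
      unfolding h_def by (intro dual_restriction_disjoint g v_nonneg)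
    thus "inf \<bar>h m\<bar> \<bar>h n\<bar> = 0" by (simp add: h_def dual_restriction_nonneg g)
  qed
  moreover have "weakly_null h"
    using g(1) by (rule weakly_null_dominated)
      (simp_all add: h_def dual_restriction_nonneg dual_restriction_le g)
  ultimately have "uniform_limit A (\<lambda>n. dual_apply (h n)) (\<lambda>_. 0) sequentially"
    using A(1) by (simp add: almost_Dunford_Pettis_def)
  hence "\<forall>\<^sub>F n in sequentially. \<forall>y\<in>A. dist (dual_apply (h n) y) 0 < \<epsilon> / 2"
    using \<epsilon> by (intro uniform_limitD) simp_all
  moreover have "\<forall>\<^sub>F n in sequentially. dual_apply (g n) x < \<epsilon> / 4"
    using weakly_null_dual_pointwise[OF g(1), of x] by (rule order_tendstoD) (use \<epsilon> in simp)
  ultimately have "\<forall>\<^sub>F n in sequentially. False"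
  proof eventually_elim
    case (elim n)
    have "inverse (2 ^ n) * dual_apply (g n) x \<le> 1 * dual_apply (g n) x"
      using g(2) x by (intro mult_right_mono dual_nonneg_apply) (simp_all add: inverse_le_1_iff)
    hence "\<epsilon> / 2 \<le> dual_apply (g n) (a n - 4 ^ n *\<^sub>R (\<Sum>i<n. a i) - inverse (2 ^ n) *\<^sub>R x)"
      using large[of n] small[of n] elim(2) by simp
    also have "\<dots> \<le> dual_apply (g n) (v n)"
      by (intro dual_apply_mono g) (simp add: v_def pprt_def)
    also have "\<dots> = dual_apply (h n) (v n)"
      by (simp add: h_def dual_restriction_self g v_nonneg)
    finally show False using elim(1) v_A[of n] by force
  qed
  thus False by simp
qed

text \<open>If uniform convergence fails, large values occur at arbitrarily late indices. Choosing
  each index so late that its functional is tiny on the sum of the elements already chosen yields a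
  subsequence excluded by \<open>almost_Dunford_Pettis_diagonal\<close>.\<close>

lemma almost_Dunford_Pettis_uniform_limit:
  fixes g :: "nat \<Rightarrow> 'e::banach_lattice dual"
  assumes A: "almost_Dunford_Pettis A" "solid A"
    and g: "weakly_null (\<lambda>n. \<bar>g n\<bar>)"
  shows "uniform_limit A (\<lambda>n. dual_apply (g n)) (\<lambda>_. 0) sequentially"
proof (rule ccontr)
  assume "\<not> ?thesis"
  then obtain \<epsilon> where \<epsilon>: "0 < \<epsilon>"
    and freq: "\<not> (\<forall>\<^sub>F n in sequentially. \<forall>x\<in>A. \<bar>dual_apply (g n) x\<bar> < \<epsilon>)"
    unfolding uniform_limit_iff dist_real_def diff_0_right by blast
  define P where "P n a \<longleftrightarrow> a \<in> A \<and> 0 \<le> a \<and> \<epsilon> \<le> dual_apply \<bar>g n\<bar> a" for n a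
  have ex: "\<exists>n>N. \<exists>a. P n a" for N
  proof -
    have "\<exists>n\<ge>Suc N. \<not> (\<forall>x\<in>A. \<bar>dual_apply (g n) x\<bar> < \<epsilon>)"
      using freq unfolding eventually_sequentially by blast
    then obtain n x where n: "N < n" "x \<in> A" "\<epsilon> \<le> \<bar>dual_apply (g n) x\<bar>"
      by (auto simp: not_less Suc_le_eq)
    \<comment> \<open>Solidity permits the passage to the modulus, which makes the element positive
      without lowering the value.\<close>
    have "\<bar>x\<bar> \<in> A" using A(2)[unfolded solid_def, rule_format, OF n(2), of "\<bar>x\<bar>"] by simp
    moreover have "\<epsilon> \<le> dual_apply \<bar>g n\<bar> \<bar>x\<bar>"
      using n(3) abs_dual_apply_le by (rule order_trans)
    ultimately have "P n \<bar>x\<bar>" by (simp add: P_def)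
    thus ?thesis using n(1) by blast
  qed
  \<comment> \<open>A state of the recursion consists of the index, the chosen element of \<open>A\<close>, and the sum of
    the elements chosen before.\<close>
  define Q :: "nat \<Rightarrow> nat \<times> 'e \<times> 'e \<Rightarrow> bool"
    where "Q n = (\<lambda>(k, a, s). P k a \<and> (n = 0 \<longrightarrow> s = 0))" for n
  \<comment> \<open>The exponent is \<open>Suc n\<close> because the condition concerns the new
    state, whose third component is the sum of the first \<open>Suc n\<close> chosen
    elements.\<close>
  define R :: "nat \<Rightarrow> nat \<times> 'e \<times> 'e \<Rightarrow> nat \<times> 'e \<times> 'e \<Rightarrow> bool"
    where "R n = (\<lambda>(k, a, s) (k', a', s'). k < k' \<and> s' = s + a \<and>
      4 ^ Suc n * dual_apply \<bar>g k'\<bar> s' \<le> \<epsilon> / 4)" for n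
  have "\<exists>c. \<forall>n. Q n (c n) \<and> R n (c n) (c (Suc n))"
  proof (rule dependent_nat_choice)
    show "\<exists>t. Q 0 t" using ex[of 0] by (auto simp: Q_def)
    fix t :: "nat \<times> 'e \<times> 'e" and n
    obtain k a s where t: "t = (k, a, s)" by (cases t)
    \<comment> \<open>The vector \<open>s + a\<close> is fixed before the next index is chosen, so
      pointwise convergence suffices.\<close>
    have "(\<lambda>m. 4 ^ Suc n * dual_apply \<bar>g m\<bar> (s + a)) \<longlonglongrightarrow> 0"
      by (intro tendsto_mult_right_zero weakly_null_dual_pointwise g)
    hence "\<forall>\<^sub>F m in sequentially. 4 ^ Suc n * dual_apply \<bar>g m\<bar> (s + a) < \<epsilon> / 4"
      by (rule order_tendstoD) (use \<epsilon> in simp)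
    then obtain N where N: "\<And>m. N \<le> m \<Longrightarrow> 4 ^ Suc n * dual_apply \<bar>g m\<bar> (s + a) < \<epsilon> / 4"
      by (auto simp: eventually_sequentially)
    obtain k' a' where k': "max k N < k'" "P k' a'" using ex by blast
    hence "4 ^ Suc n * dual_apply \<bar>g k'\<bar> (s + a) \<le> \<epsilon> / 4" using N[of k'] by (intro less_imp_le) simp
    hence "Q (Suc n) (k', a', s + a) \<and> R n t (k', a', s + a)"
      using k' by (simp add: Q_def R_def t)
    thus "\<exists>t'. Q (Suc n) t' \<and> R n t t'" by blast
  qed
  then obtain c where c: "\<And>n. Q n (c n)" "\<And>n. R n (c n) (c (Suc n))" by blast
  define k a s where "k n = fst (c n)" and "a n = fst (snd (c n))" and "s n = snd (snd (c n))" for n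
  have P: "P (k n) (a n)" for n
    using c(1)[of n] by (simp add: Q_def k_def a_def case_prod_beta)
  have R: "k n < k (Suc n)" "s (Suc n) = s n + a n"
    "4 ^ Suc n * dual_apply \<bar>g (k (Suc n))\<bar> (s (Suc n)) \<le> \<epsilon> / 4" for n
    using c(2)[of n] by (auto simp: R_def k_def a_def s_def case_prod_beta)
  have s0: "s 0 = 0" using c(1)[of 0] by (simp add: Q_def s_def case_prod_beta)
  hence s: "s n = (\<Sum>i<n. a i)" for n
    by (induction n) (simp_all add: R)
  have "\<exists>n. dual_apply \<bar>g (k n)\<bar> (a n) < \<epsilon>"
  proof (rule almost_Dunford_Pettis_diagonal[OF A])
    show "weakly_null (\<lambda>n. \<bar>g (k n)\<bar>)"
      by (rule weakly_null_subseq[OF g]) (use R(1) in \<open>simp add: strict_mono_Suc_iff\<close>)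
    \<comment> \<open>At index 0 the sum is empty; every later index is covered by
      \<open>R\<close>.\<close>
    show "4 ^ n * dual_apply \<bar>g (k n)\<bar> (\<Sum>i<n. a i) \<le> \<epsilon> / 4" for n
      using R(3) \<epsilon> by (cases n) (simp_all add: s)
  qed (use P \<epsilon> in \<open>auto simp: P_def\<close>)
  thus False using P unfolding P_def by (meson not_less)
qed

theorem theorem2p26:
  fixes T :: "'e::banach_lattice \<Rightarrow> 'f::banach_lattice"
  assumes "weakly_seq_continuous_lattice_ops TYPE('e dual)"
    and "bounded_linear T"
    and "almost_Dunford_Pettis A"
    and "solid A"
  shows "almost_Dunford_Pettis (T ` A)"
  unfolding almost_Dunford_Pettis_def
proof (intro conjI allI impI)
  show "bounded (T ` A)"
    using assms(2,3) by (simp add: almost_Dunford_Pettis_def bounded_linear_image)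
  fix f :: "nat \<Rightarrow> 'f dual"
  assume f: "disjoint_seq f \<and> weakly_null f"
  obtain S :: "'f dual \<Rightarrow> 'e dual"
    where S: "bounded_linear S" "\<And>f x. dual_apply (S f) x = dual_apply f (T x)"
    using ex_adjoint[OF assms(2)] by blast
  have "weakly_null (\<lambda>n. S (f n))"
    by (rule weakly_null_image[OF S(1)]) (use f in simp)
  hence "weakly_null (\<lambda>n. \<bar>S (f n)\<bar>)"
    using assms(1) by (simp add: weakly_seq_continuous_lattice_ops_def)
  with assms(3,4) have "uniform_limit A (\<lambda>n. dual_apply (S (f n))) (\<lambda>_. 0) sequentially"
    by (rule almost_Dunford_Pettis_uniform_limit)
  thus "uniform_limit (T ` A) (\<lambda>n. dual_apply (f n)) (\<lambda>_. 0) sequentially"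
    by (simp add: uniform_limit_iff S(2))
qed

end
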